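(* Up to monomial equivalence there are exactly three quasi self-dual codes over $I_5$ of length $2$ and type $\{1,0\}$. Representatives are the codes with generator matrices $$(\mathtt{a}\ \ 2\mathtt{a}),\qquad (\mathtt{a}\ \ 2\mathtt{a}+\mathtt{b}),\qquad (\mathtt{a}\ \ 2\mathtt{a}+2\mathtt{b}),$$ which are pairwise monomially inequivalent and have automorphism groups of orders $4$, $2$, $2$ respectively. Each of these codes has minimum distance $2$, with $24$ codewords of weight $2$ (besides the zero codeword).
   Context: $I_5$ is the commutative ring without unity of order 25 and characteristic 5 generated by $\mathtt{a},\mathtt{b}$ with relations $5\mathtt{a}=5\mathtt{b}=0$, $\mathtt{a}^2=\mathtt{b}$, $\mathtt{a}\mathtt{b}=0$ (hence $\mathtt{b}^2=0$); every element is uniquely $\mathtt{a}x+\mathtt{b}y$ with $x,y\in\mathbb{F}_5$. A linear code of length $n$ over $I_5$ is an $I_5$-submodule of $I_5^n$; the code with generator matrix $G$ is the smallest $I_5$-submodule (additive subgroup closed under multiplication by $I_5$) containing the rows of $G$. Let $\pi:I_5\to\mathbb{F}_5$, $\pi(\mathtt{a}x+\mathtt{b}y)=x$, extended coordinatewise; $\operatorname{res}(\mathcal{C})=\pi(\mathcal{C})$ and $\operatorname{tor}(\mathcal{C})=\{\mathbf{x}\in\mathbb{F}_5^n:\mathtt{b}\mathbf{x}\in\mathcal{C}\}$. $\mathcal{C}$ has type $\{k_1,k_2\}$ if $\dim\operatorname{res}(\mathcal{C})=k_1$ and $\dim\operatorname{tor}(\mathcal{C})=k_1+k_2$. $\mathcal{C}$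 is self-orthogonal if $\sum_i y_iz_i=0$ for all $\mathbf{y},\mathbf{z}\in\mathcal{C}$, and quasi self-dual if it is self-orthogonal of size $5^n$. Two codes $\mathcal{C},\mathcal{C}'$ of length $n$ are monomially equivalent if $\mathcal{C}'=\{\mathbf{c}M:\mathbf{c}\in\mathcal{C}\}$ for some $n\times n$ monomial matrix $M$ (exactly one nonzero entry in each row and column) with nonzero entries in $\{1,-1\}$; $\operatorname{Aut}(\mathcal{C})$ is the group of such $M$ with $\mathcal{C}M=\mathcal{C}$. The weight of a vector is its number of nonzero coordinates; the minimum distance is the least weight of a nonzero codeword. *)

theory Defs
  imports "HOL-Analysis.Analysis" "Berlekamp_Zassenhaus.Finite_Field"
begin

text \<open>The residue field: \<^typ>\<open>'a mod_ring\<close> is a field once its index type has prime cardinality.\<close>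

typedef five = "{..<5::nat}"
  by (rule exI[of _ 0]) simp

lemma card_five [simp]: "CARD(five) = 5"
  using type_definition.card[OF type_definition_five] by simp

instance five :: prime_card
  by standard simp

type_synonym f5 = "five mod_ring"

text \<open>\<open>I5 x y\<close> stands for the element \<open>a x + b y\<close> of the ring. There is no unit,
  hence the class \<^class>\<open>comm_ring\<close>.\<close>

datatype i5 = I5 (coeff_a: f5) (coeff_b: f5)

instantiation i5 :: comm_ring
begin

definition zero_i5 :: i5 where
  "0 = I5 0 0"

definition plus_i5 :: "i5 \<Rightarrow> i5 \<Rightarrow> i5" where
  "u + v = I5 (coeff_a u + coeff_a v) (coeff_b u + coeff_b v)"

definition uminus_i5 :: "i5 \<Rightarrow> i5" where
  "- u = I5 (- coeff_a u) (- coeff_b u)"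

definition minus_i5 :: "i5 \<Rightarrow> i5 \<Rightarrow> i5" where
  "u - v = I5 (coeff_a u - coeff_a v) (coeff_b u - coeff_b v)"

definition times_i5 :: "i5 \<Rightarrow> i5 \<Rightarrow> i5" where
  "u * v = I5 0 (coeff_a u * coeff_a v)"

instance
  by standard
    (auto simp: zero_i5_def plus_i5_def uminus_i5_def minus_i5_def times_i5_def algebra_simps)

end

definition ring_a :: i5 where
  "ring_a = I5 1 0"

definition ring_b :: i5 where
  "ring_b = I5 0 1"

definition f5_scale :: "f5 \<Rightarrow> i5 \<Rightarrow> i5" (infixr "\<cdot>\<^sub>5" 75) where
  "x \<cdot>\<^sub>5 u = I5 (x * coeff_a u) (x * coeff_b u)"

lemma f5_scale_simps:
  "0 \<cdot>\<^sub>5 u = 0" "1 \<cdot>\<^sub>5 u = u" "(x + y) \<cdot>\<^sub>5 u = x \<cdot>\<^sub>5 u + y \<cdot>\<^sub>5 u"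
  by (auto simp: f5_scale_def zero_i5_def plus_i5_def algebra_simps)

lemma I5_eq: "I5 x y = x \<cdot>\<^sub>5 ring_a + y \<cdot>\<^sub>5 ring_b"
  by (simp add: f5_scale_def ring_a_def ring_b_def plus_i5_def)

lemma i5_relations:
  "ring_a * ring_a = ring_b" "ring_a * ring_b = 0" "ring_b * ring_b = 0"
  "(\<Sum>i<5::nat. u) = (0::i5)"
proof -
  have five: "(5::f5) = 0"
    using of_nat_card_eq_0[where 'a = five] by simp
  show "(\<Sum>i<5::nat. u) = (0::i5)"
    by (simp add: lessThan_Suc eval_nat_numeral plus_i5_def zero_i5_def five)
qed (auto simp: ring_a_def ring_b_def times_i5_def zero_i5_def)

lemma card_i5: "CARD(i5) = 25"
proof -
  have "bij (\<lambda>(x, y). I5 x y)"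
    by (rule bij_betw_byWitness[where f' = "\<lambda>u. (coeff_a u, coeff_b u)"]) auto
  then have "CARD(i5) = CARD(f5 \<times> f5)"
    by (metis bij_betw_same_card)
  then show ?thesis
    by simp
qed

instance i5 :: finite
  by standard (metis card_i5 card.infinite zero_neq_numeral)


definition linear_code :: "(i5 ^ 'n::finite) set \<Rightarrow> bool" where
  "linear_code C \<longleftrightarrow>
     0 \<in> C \<and> (\<forall>u\<in>C. \<forall>v\<in>C. u + v \<in> C) \<and> (\<forall>u\<in>C. - u \<in> C) \<and> (\<forall>r. \<forall>u\<in>C. r *s u \<in> C)"

definition generated_code :: "i5 ^ 'n::finite ^ 'm::finite \<Rightarrow> (i5 ^ 'n) set" where
  "generated_code G = linear_code hull rows G"

lemma linear_code_generated_code: "linear_code (generated_code G)"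
  unfolding generated_code_def by (rule hull_in) (auto simp: linear_code_def)

definition res :: "(i5 ^ 'n::finite) set \<Rightarrow> (f5 ^ 'n) set" where
  "res C = (\<lambda>c. \<chi> i. coeff_a (c $ i)) ` C"

definition tor :: "(i5 ^ 'n::finite) set \<Rightarrow> (f5 ^ 'n) set" where
  "tor C = {x. (\<chi> i. x $ i \<cdot>\<^sub>5 ring_b) \<in> C}"

definition has_type :: "(i5 ^ 'n::finite) set \<Rightarrow> nat \<Rightarrow> nat \<Rightarrow> bool" where
  "has_type C k1 k2 \<longleftrightarrow> vec.dim (res C) = k1 \<and> vec.dim (tor C) = k1 + k2"

definition self_orthogonal :: "(i5 ^ 'n::finite) set \<Rightarrow> bool" where
  "self_orthogonal C \<longleftrightarrow> (\<forall>y\<in>C. \<forall>z\<in>C. (\<Sum>i\<in>UNIV. y $ i * z $ i) = 0)"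

definition quasi_self_dual :: "(i5 ^ 'n::finite) set \<Rightarrow> bool" where
  "quasi_self_dual C \<longleftrightarrow> linear_code C \<and> self_orthogonal C \<and> card C = 5 ^ CARD('n)"

text \<open>As the ring has no unit, the entries of a monomial matrix live in the field,
  where \<open>1 \<noteq> - 1\<close>, and act on the ring by scalars.\<close>

definition monomial_matrix :: "f5 ^ 'n::finite ^ 'n \<Rightarrow> bool" where
  "monomial_matrix M \<longleftrightarrow>
     (\<forall>i. \<exists>!j. M $ i $ j \<noteq> 0) \<and> (\<forall>j. \<exists>!i. M $ i $ j \<noteq> 0) \<and>
     (\<forall>i j. M $ i $ j \<noteq> 0 \<longrightarrow> M $ i $ j \<in> {1, - 1})"

definition vec_mult :: "i5 ^ 'n::finite \<Rightarrow> f5 ^ 'n ^ 'n \<Rightarrow> i5 ^ 'n" where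
  "vec_mult c M = (\<chi> j. \<Sum>i\<in>UNIV. M $ i $ j \<cdot>\<^sub>5 c $ i)"

definition code_mult :: "(i5 ^ 'n::finite) set \<Rightarrow> f5 ^ 'n ^ 'n \<Rightarrow> (i5 ^ 'n) set" where
  "code_mult C M = (\<lambda>c. vec_mult c M) ` C"

definition monomially_equivalent :: "(i5 ^ 'n::finite) set \<Rightarrow> (i5 ^ 'n) set \<Rightarrow> bool" where
  "monomially_equivalent C C' \<longleftrightarrow> (\<exists>M. monomial_matrix M \<and> C' = code_mult C M)"

definition Aut :: "(i5 ^ 'n::finite) set \<Rightarrow> (f5 ^ 'n ^ 'n) set" where
  "Aut C = {M. monomial_matrix M \<and> code_mult C M = C}"

definition weight :: "i5 ^ 'n::finite \<Rightarrow> nat" where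
  "weight c = card {i. c $ i \<noteq> 0}"

definition min_distance :: "(i5 ^ 'n::finite) set \<Rightarrow> nat" where
  "min_distance C = (LEAST w. \<exists>c\<in>C. c \<noteq> 0 \<and> weight c = w)"

end

theory Submission
  imports Defs
begin

text \<open>The residue code of a quasi self-dual code of type $\{1,0\}$ is an isotropic line, spanned by
  $(1, t)$ with $t^2 = -1$. The code therefore contains, after adding a multiple of $\mathtt{b}(1, t)$,
  a word $(\mathtt{a}, \mathtt{a}t + \mathtt{b}s)$, and by size it is generated by that word. The signed
  permutations act on the parameters $(t, s)$ by independent sign changes (the swap fixes $s$ and
  sends $t$ to $t^{-1} = -t$), so $s^2 \in \{0, 1, -1\}$ is a complete invariant.\<close>

section \<open>The field of five elements\<close>

lemma f5_five: "(5::f5) = 0"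
  using of_nat_card_eq_0[where 'a = five] by simp

lemma f5_two_neq_0: "(2::f5) \<noteq> 0"
proof
  assume two: "(2::f5) = 0"
  have "(5::f5) = 2 + 2 + 1"
    by simp
  then show False
    unfolding f5_five two by simp
qed

lemma f5_neq_uminus: "(x::f5) = - x \<longleftrightarrow> x = 0"
proof
  assume "x = - x"
  then have "2 * x = 0"
    by (metis add.right_inverse mult_2)
  then show "x = 0"
    using f5_two_neq_0 by simp
qed simp

lemma f5_one_neq: "(1::f5) \<noteq> - 1" "(- 1::f5) \<noteq> 1"
  using f5_neq_uminus[of 1] by auto

lemma f5_two_squared: "(2::f5)\<^sup>2 = - 1"
proof -
  have "(2::f5)\<^sup>2 + 1 = 5"
    by (simp add: power2_eq_square)
  then show ?thesis
    by (simp add: f5_five eq_neg_iff_add_eq_0)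
qed

text \<open>The listed elements are pairwise distinct and there are five of them, so they fill the
  field. This signed form suits arguments about sign changes.\<close>

lemma f5_exhaust: "(x::f5) \<in> {0, 1, - 1, 2, - 2}"
proof -
  \<comment> \<open>The squares \<open>1\<close> and \<open>- 1\<close> separate 2 from 1 and from
    \<open>- 1\<close>.\<close>
  have "1 \<noteq> (2::f5)" "- 1 \<noteq> (2::f5)"
    using f5_two_squared f5_one_neq by (metis one_power2, metis power2_minus one_power2)
  moreover have "2 \<noteq> (- 2::f5)"
    using f5_neq_uminus[of 2] f5_two_neq_0 by simp
  ultimately have "card {0, 1, - 1, 2, - 2 :: f5} = 5"
    using f5_one_neq f5_two_neq_0
    by (auto simp: card_insert_if minus_equation_iff)
  then have "{0, 1, - 1, 2, - 2 :: f5} = UNIV"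
    by (intro card_subset_eq) simp_all
  then show ?thesis
    by blast
qed

text \<open>The value \<open>- 1\<close> is written as the square of 2, so that the cases match the
  parameters \<open>s\<close> = 0, 1, 2 of the three representatives.\<close>

lemma f5_square_cases: "(x::f5)\<^sup>2 \<in> {0, 1, 2\<^sup>2}"
  using f5_exhaust[of x] f5_two_squared by auto

lemma sqrt_minus_1_unique:
  fixes t t' :: f5
  assumes "t\<^sup>2 = - 1" "t'\<^sup>2 = - 1"
  shows "t' = t \<or> t' = - t"
  using assms by (metis power2_eq_iff)


section \<open>The codes\<close>

text \<open>The code generated by (a, at + bs), as the graph of an additive map: the first
  coordinate ax + by is free, and the second is a(tx) + b(sx + ty).\<close>

definition code :: "f5 \<Rightarrow> f5 \<Rightarrow> (i5 ^ 2) set" where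
  "code t s = {c. c $ 2 = I5 (t * coeff_a (c $ 1)) (s * coeff_a (c $ 1) + t * coeff_b (c $ 1))}"

lemma linear_code_code: "linear_code (code t s)"
  by (auto simp: linear_code_def code_def zero_i5_def plus_i5_def uminus_i5_def times_i5_def
      algebra_simps)

text \<open>Without a unit, field scalars do not come from the ring action. They come from the
  additive group, since each one is 0 or, up to sign, 1 or 1 + 1.\<close>

lemma linear_code_f5_scale:
  assumes "linear_code C" "u \<in> C"
  shows "(\<chi> i. x \<cdot>\<^sub>5 u $ i) \<in> C"
proof -
  have add: "u + u \<in> C" and neg: "\<And>v. v \<in> C \<Longrightarrow> - v \<in> C" and zero: "0 \<in> C"
    using assms by (auto simp: linear_code_def)
  have "(\<chi> i. 0 \<cdot>\<^sub>5 u $ i) = 0" "(\<chi> i. 1 \<cdot>\<^sub>5 u $ i) = u"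
    by (simp_all add: vec_eq_iff f5_scale_simps)
  moreover have "(\<chi> i. 2 \<cdot>\<^sub>5 u $ i) = u + u"
    using f5_scale_simps(3)[of 1 1] by (simp add: vec_eq_iff f5_scale_simps(2))
  moreover have "(\<chi> i. (- y) \<cdot>\<^sub>5 u $ i) = - (\<chi> i. y \<cdot>\<^sub>5 u $ i)" for y
    by (simp add: vec_eq_iff f5_scale_def uminus_i5_def)
  ultimately show ?thesis
    using f5_exhaust[of x] assms(2) add neg[OF assms(2)] neg[OF add] zero by auto
qed

lemma rows_singleton: "rows (vector [g] :: 'a::zero ^ 'n ^ 1) = {g}"
  by (auto simp: rows_def row_def vec_eq_iff forall_1)

lemma generated_code_eq_code:
  "generated_code (vector [vector [ring_a, I5 t s]] :: i5 ^ 2 ^ 1) = code t s"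
proof -
  define g :: "i5 ^ 2" where "g = vector [ring_a, I5 t s]"
  have "linear_code hull {g} = code t s"
  proof (rule hull_unique)
    show "{g} \<subseteq> code t s"
      by (simp add: g_def code_def ring_a_def)
    show "linear_code (code t s)"
      by (rule linear_code_code)
  next
    fix D assume D: "{g} \<subseteq> D" "linear_code D"
    have g: "g \<in> D" and add: "\<And>u v. u \<in> D \<Longrightarrow> v \<in> D \<Longrightarrow> u + v \<in> D"
      and smult: "\<And>r u. u \<in> D \<Longrightarrow> r *s u \<in> D"
      using D by (auto simp: linear_code_def)
    show "code t s \<subseteq> D"
    proof
      fix c assume c: "c \<in> code t s"
      \<comment> \<open>The field multiple supplies the residue part x(a, at + bs). Multiplying the
        generator by ay leaves only the torsion part by(1, t).\<close>
      have "c = (\<chi> i. coeff_a (c $ 1) \<cdot>\<^sub>5 g $ i) + I5 (coeff_b (c $ 1)) 0 *s g"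
        using c by (simp add: code_def vec_eq_iff forall_2 g_def ring_a_def f5_scale_def plus_i5_def
            times_i5_def mult.commute)
      then show "c \<in> D"
        using add[OF linear_code_f5_scale[OF D(2) g] smult[OF g]] by metis
    qed
  qed
  then show ?thesis
    by (simp add: generated_code_def rows_singleton flip: g_def)
qed

section \<open>Size, self-orthogonality and type of the codes\<close>

lemma code_eq_range:
  "code t s = range (\<lambda>u. vector [u, I5 (t * coeff_a u) (s * coeff_a u + t * coeff_b u)])"
  (is "_ = range ?f")
proof (intro equalityI subsetI)
  fix c assume "c \<in> code t s"
  then have "c = ?f (c $ 1)"
    by (simp add: code_def vec_eq_iff forall_2)
  then show "c \<in> range ?f"
    by blast
qed (auto simp: code_def)

lemma card_code: "card (code t s) = 25"
proof -
  have "inj (\<lambda>u. vector [u, I5 (t * coeff_a u) (s * coeff_a u + t * coeff_b u)] :: i5 ^ 2)"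
    by (rule injI) (metis vector_2(1))
  then show ?thesis
    by (simp add: code_eq_range card_image card_i5)
qed

text \<open>A product in the ring sees only the coefficients of a, so two words with first such
  coefficients x and y have inner product b(1 + t^2)xy.\<close>

lemma self_orthogonal_code:
  assumes "t\<^sup>2 = - 1"
  shows "self_orthogonal (code t s)"
proof -
  have "x * y + t * x * (t * y) = 0" for x y
  proof -
    have "x * y + t * x * (t * y) = (1 + t\<^sup>2) * (x * y)"
      by (simp add: algebra_simps power2_eq_square)
    then show ?thesis
      using assms by simp
  qed
  then show ?thesis
    by (simp add: self_orthogonal_def code_def sum_2 plus_i5_def times_i5_def zero_i5_def)
qed

text \<open>This line is both the residue and the torsion code of \<open>code t s\<close>, which
  gives type {1, 0}.\<close>

lemma dim_line: "vec.dim {v :: f5 ^ 2. v $ 2 = t * v $ 1} = 1"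
proof -
  have "{v :: f5 ^ 2. v $ 2 = t * v $ 1} = vec.span {vector [1, t]}"
  proof (intro equalityI subsetI)
    fix v :: "f5 ^ 2" assume "v \<in> {v. v $ 2 = t * v $ 1}"
    then have "v = v $ 1 *s vector [1, t]"
      by (simp add: vec_eq_iff forall_2)
    then show "v \<in> vec.span {vector [1, t]}"
      unfolding vec.span_singleton by (rule range_eqI)
  qed (auto simp: vec.span_singleton)
  moreover have "(vector [1, t] :: f5 ^ 2) \<noteq> 0"
    by (simp add: vec_eq_iff forall_2)
  ultimately show ?thesis
    by (simp add: vec.dim_insert)
qed

lemma res_code: "res (code t s) = {v. v $ 2 = t * v $ 1}"
proof (intro equalityI subsetI)
  fix v :: "f5 ^ 2" assume v: "v \<in> {v. v $ 2 = t * v $ 1}"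
  have "v = (\<chi> i. coeff_a ((vector [I5 (v $ 1) 0, I5 (v $ 2) (s * v $ 1)] :: i5 ^ 2) $ i))"
    by (simp add: vec_eq_iff forall_2)
  moreover have "vector [I5 (v $ 1) 0, I5 (v $ 2) (s * v $ 1)] \<in> code t s"
    using v by (simp add: code_def)
  ultimately show "v \<in> res (code t s)"
    unfolding res_def by blast
qed (auto simp: res_def code_def)

lemma tor_code: "tor (code t s) = {v. v $ 2 = t * v $ 1}"
  by (auto simp: tor_def code_def f5_scale_def ring_b_def)

lemma code_quasi_self_dual:
  assumes "t\<^sup>2 = - 1"
  shows "quasi_self_dual (code t s) \<and> has_type (code t s) 1 0"
  using assms
  by (simp add: quasi_self_dual_def linear_code_code self_orthogonal_code card_code has_type_def
      res_code tor_code dim_line)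

lemma quasi_self_dual_type_1_0_imp_code:
  fixes C :: "(i5 ^ 2) set"
  assumes "quasi_self_dual C" and "has_type C 1 0"
  obtains t s where "t\<^sup>2 = - 1" "C = code t s"
proof -
  have add: "\<And>u v. u \<in> C \<Longrightarrow> v \<in> C \<Longrightarrow> u + v \<in> C"
    and smult: "\<And>r u. u \<in> C \<Longrightarrow> r *s u \<in> C" and card: "card C = 25"
    and lin: "linear_code C"
    and orth: "\<And>y z. y \<in> C \<Longrightarrow> z \<in> C \<Longrightarrow> (\<Sum>i\<in>UNIV. y $ i * z $ i) = 0"
    using assms by (auto simp: quasi_self_dual_def linear_code_def self_orthogonal_def)
  have "\<not> res C \<subseteq> {0}"
  proof
    assume "res C \<subseteq> {0}"
    then have "vec.dim (res C) = 0"
      by simp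
    then show False
      using assms(2) unfolding has_type_def by linarith
  qed
  then obtain d where d: "d \<in> C" and "(\<chi> i. coeff_a (d $ i)) \<noteq> 0"
    by (auto simp: res_def)
  then have nz: "coeff_a (d $ 1) \<noteq> 0 \<or> coeff_a (d $ 2) \<noteq> 0"
    by (auto simp: vec_eq_iff forall_2)
  \<comment> \<open>Orthogonality of \<open>d\<close> to itself makes its residue isotropic. A zero
    first entry would then force the second to vanish too.\<close>
  have iso: "coeff_a (d $ 1) ^ 2 + coeff_a (d $ 2) ^ 2 = 0"
    using orth[OF d d] by (simp add: sum_2 plus_i5_def times_i5_def zero_i5_def power2_eq_square)
  then have nz1: "coeff_a (d $ 1) \<noteq> 0"
    using nz by auto
  define t where "t = coeff_a (d $ 2) / coeff_a (d $ 1)"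
  have "coeff_a (d $ 2) ^ 2 = - (coeff_a (d $ 1) ^ 2)"
    using iso by (simp add: eq_neg_iff_add_eq_0 add.commute)
  then have t: "t\<^sup>2 = - 1"
    using nz1 by (simp add: t_def power_divide)
  \<comment> \<open>Scaling by \<open>x\<close> normalises the first coefficient of a to 1.\<close>
  define x where "x = inverse (coeff_a (d $ 1))"
  define e where "e = (\<chi> i. x \<cdot>\<^sub>5 d $ i)"
  have e: "e \<in> C"
    unfolding e_def by (rule linear_code_f5_scale[OF lin d])
  have e_a: "coeff_a (e $ 1) = 1" "coeff_a (e $ 2) = t"
    using nz1 by (simp_all add: e_def x_def t_def f5_scale_def field_simps)
  \<comment> \<open>Clearing the b-part of the first coordinate of \<open>e\<close> subtracts a
    multiple of b(1, t); \<open>s\<close> is the b-coefficient that then remains in the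
    second.\<close>
  define s where "s = coeff_b (e $ 2) - t * coeff_b (e $ 1)"
  have "vector [ring_a, I5 t s] = e + I5 (- coeff_b (e $ 1)) 0 *s e"
    using e_a by (simp add: vec_eq_iff forall_2 ring_a_def plus_i5_def times_i5_def s_def
        i5.expand algebra_simps)
  then have "vector [ring_a, I5 t s] \<in> C"
    using add[OF e smult[OF e]] by metis
  then have "rows (vector [vector [ring_a, I5 t s]] :: i5 ^ 2 ^ 1) \<subseteq> C"
    by (auto simp: rows_singleton)
  then have "code t s \<subseteq> C"
    using hull_minimal lin unfolding generated_code_eq_code[symmetric] generated_code_def by metis
  \<comment> \<open>Both codes have 25 words, so the inclusion is an equality.\<close>
  then have "C = code t s"
    using card card_code by (metis card_subset_eq finite)
  with t show ?thesis
    by (rule that)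
qed


section \<open>Monomial matrices of size two\<close>

definition diag2 :: "f5 \<Rightarrow> f5 \<Rightarrow> f5 ^ 2 ^ 2" where
  "diag2 p q = vector [vector [p, 0], vector [0, q]]"

definition antidiag2 :: "f5 \<Rightarrow> f5 \<Rightarrow> f5 ^ 2 ^ 2" where
  "antidiag2 p q = vector [vector [0, p], vector [q, 0]]"

lemma exists_2: "(\<exists>i::2. P i) \<longleftrightarrow> P 1 \<or> P 2"
  by (metis exhaust_2)

text \<open>A permutation of two coordinates is trivial or the swap, and two signs are free: eight
  matrices in all.\<close>

lemma monomial_matrix_2:
  "monomial_matrix M \<longleftrightarrow>
    (\<exists>p\<in>{1, - 1}. \<exists>q\<in>{1, - 1}. M = diag2 p q \<or> M = antidiag2 p q)"
proof
  assume M: "monomial_matrix M"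
  let ?P = "\<lambda>i j. M $ i $ j \<noteq> 0"
  have "(?P 1 1 \<and> \<not> ?P 1 2 \<and> \<not> ?P 2 1 \<and> ?P 2 2) \<or> (\<not> ?P 1 1 \<and> ?P 1 2 \<and> ?P 2 1 \<and> \<not> ?P 2 2)"
    using M unfolding monomial_matrix_def Ex1_def forall_2 exists_2 by auto
  moreover have "\<And>i j. M $ i $ j \<noteq> 0 \<Longrightarrow> M $ i $ j \<in> {1, - 1}"
    using M by (auto simp: monomial_matrix_def)
  moreover have "M = diag2 (M $ 1 $ 1) (M $ 2 $ 2)" if "M $ 1 $ 2 = 0" "M $ 2 $ 1 = 0"
    using that by (simp add: diag2_def vec_eq_iff forall_2)
  moreover have "M = antidiag2 (M $ 1 $ 2) (M $ 2 $ 1)" if "M $ 1 $ 1 = 0" "M $ 2 $ 2 = 0"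
    using that by (simp add: antidiag2_def vec_eq_iff forall_2)
  ultimately show "\<exists>p\<in>{1, - 1}. \<exists>q\<in>{1, - 1}. M = diag2 p q \<or> M = antidiag2 p q"
    by meson
next
  assume "\<exists>p\<in>{1, - 1}. \<exists>q\<in>{1, - 1}. M = diag2 p q \<or> M = antidiag2 p q"
  then show "monomial_matrix M"
    by (auto simp: monomial_matrix_def diag2_def antidiag2_def forall_2 exists_2 Ex1_def)
qed

lemma vec_mult_diag2: "vec_mult c (diag2 p q) = vector [p \<cdot>\<^sub>5 c $ 1, q \<cdot>\<^sub>5 c $ 2]"
  by (simp add: vec_mult_def diag2_def vec_eq_iff forall_2 sum_2 f5_scale_simps)

lemma vec_mult_antidiag2: "vec_mult c (antidiag2 p q) = vector [q \<cdot>\<^sub>5 c $ 2, p \<cdot>\<^sub>5 c $ 1]"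
  by (simp add: vec_mult_def antidiag2_def vec_eq_iff forall_2 sum_2 f5_scale_simps)

text \<open>For signs the quotient \<open>q / p\<close> is \<open>p * q\<close>, the common factor
  of both parameters. One inclusion suffices, because the map is injective and both codes have 25
  words.\<close>

lemma code_mult_diag2:
  assumes "p \<in> {1, - 1}" "q \<in> {1, - 1}"
  shows "code_mult (code t s) (diag2 p q) = code (p * q * t) (p * q * s)"
proof (rule card_subset_eq)
  have "p * p = 1" "q * q = 1"
    using assms by auto
  then have inj: "inj (\<lambda>c. vec_mult c (diag2 p q))"
    by (intro injI) (auto simp: vec_mult_diag2 vec_eq_iff forall_2 f5_scale_def i5.expand)
  then show "card (code_mult (code t s) (diag2 p q)) = card (code (p * q * t) (p * q * s))"
    unfolding code_mult_def by (subst card_image) (auto intro: inj_on_subset simp: card_code)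
  show "code_mult (code t s) (diag2 p q) \<subseteq> code (p * q * t) (p * q * s)"
    using assms by (auto simp: code_mult_def code_def vec_mult_diag2 f5_scale_def)
qed simp

text \<open>The swap inverts the slope, and the inverse of \<open>t\<close> is \<open>- t\<close>.
  Solving for the new second coordinate multiplies \<open>s\<close> by -1/t^2 = 1, so up to
  \<open>p * q\<close> only \<open>t\<close> changes sign.\<close>

lemma code_mult_antidiag2:
  assumes "p \<in> {1, - 1}" "q \<in> {1, - 1}" "t\<^sup>2 = - 1"
  shows "code_mult (code t s) (antidiag2 p q) = code (- (p * q) * t) (p * q * s)"
proof (rule card_subset_eq)
  have tt: "t * (t * x) = - x" for x
    using assms(3) by (metis mult.assoc mult_minus1 power2_eq_square)
  have "p \<noteq> 0" "q \<noteq> 0"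
    using assms by auto
  then have inj: "inj (\<lambda>c. vec_mult c (antidiag2 p q))"
    by (intro injI) (auto simp: vec_mult_antidiag2 vec_eq_iff forall_2 f5_scale_def i5.expand)
  then show "card (code_mult (code t s) (antidiag2 p q)) = card (code (- (p * q) * t) (p * q * s))"
    unfolding code_mult_def by (subst card_image) (auto intro: inj_on_subset simp: card_code)
  show "code_mult (code t s) (antidiag2 p q) \<subseteq> code (- (p * q) * t) (p * q * s)"
    using assms by (auto simp: code_mult_def code_def vec_mult_antidiag2 f5_scale_def tt
        algebra_simps)
qed simp

section \<open>Equality, equivalence and automorphisms in terms of the parameters\<close>

lemma code_eq_iff: "code t s = code t' s' \<longleftrightarrow> t = t' \<and> s = s'"
proof
  assume "code t s = code t' s'"
  \<comment> \<open>A code contains exactly one word with first coordinate a, and that word shows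
    both parameters.\<close>
  moreover have "vector [ring_a, I5 t s] \<in> code t s"
    by (simp add: code_def ring_a_def)
  ultimately have "vector [ring_a, I5 t s] \<in> code t' s'"
    by simp
  then show "t = t' \<and> s = s'"
    by (simp add: code_def ring_a_def)
qed simp

lemma monomially_equivalent_code_iff:
  assumes "t\<^sup>2 = - 1" "t'\<^sup>2 = - 1"
  shows "monomially_equivalent (code t s) (code t' s') \<longleftrightarrow> s\<^sup>2 = s'\<^sup>2"
proof -
  have "monomially_equivalent (code t s) (code t' s') \<longleftrightarrow>
      (\<exists>p\<in>{1, - 1}. \<exists>q\<in>{1, - 1}. code t' s' = code_mult (code t s) (diag2 p q)
        \<or> code t' s' = code_mult (code t s) (antidiag2 p q))"
    unfolding monomially_equivalent_def monomial_matrix_2 by blast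
  \<comment> \<open>Diagonal matrices change both signs or neither, antidiagonal ones exactly one;
    together they give all four sign patterns.\<close>
  also have "\<dots> \<longleftrightarrow> (t' = t \<or> t' = - t) \<and> (s' = s \<or> s' = - s)"
    using assms(1) by (auto simp: code_mult_diag2 code_mult_antidiag2 code_eq_iff)
  \<comment> \<open>The condition on \<open>t'\<close> holds automatically, as \<open>- 1\<close>
    has only the two roots \<open>t\<close> and \<open>- t\<close>.\<close>
  also have "\<dots> \<longleftrightarrow> s\<^sup>2 = s'\<^sup>2"
    using sqrt_minus_1_unique[OF assms] by (auto simp: power2_eq_iff)
  finally show ?thesis .
qed

text \<open>Fixing the nonzero \<open>t\<close> requires \<open>p * q = 1\<close> in the diagonal
  case and \<open>p * q = - 1\<close> in the antidiagonal one. The latter negates \<open>s\<close>,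
  so it survives only for \<open>s = 0\<close>.\<close>

lemma Aut_code:
  assumes "t\<^sup>2 = - 1"
  shows "Aut (code t s) = {diag2 1 1, diag2 (- 1) (- 1)} \<union>
    (if s = 0 then {antidiag2 1 (- 1), antidiag2 (- 1) 1} else {})"
proof -
  have t: "t \<noteq> 0" "- t \<noteq> t"
    using assms f5_neq_uminus[of t] by auto
  have s: "- s = s \<longleftrightarrow> s = 0"
    using f5_neq_uminus[of s] by auto
  have "Aut (code t s) =
      {M. \<exists>p\<in>{1, - 1}. \<exists>q\<in>{1, - 1}.
        M = diag2 p q \<and> code_mult (code t s) (diag2 p q) = code t s \<or>
        M = antidiag2 p q \<and> code_mult (code t s) (antidiag2 p q) = code t s}"
    unfolding Aut_def monomial_matrix_2 by blast
  also have "\<dots> =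
      {M. \<exists>p\<in>{1, - 1}. \<exists>q\<in>{1, - 1}. M = diag2 p q \<and> p * q * t = t \<and> p * q * s = s \<or>
        M = antidiag2 p q \<and> - (p * q) * t = t \<and> p * q * s = s}"
    using assms by (simp add: code_mult_diag2 code_mult_antidiag2 code_eq_iff)
  also have "\<dots> = {diag2 1 1, diag2 (- 1) (- 1)} \<union>
      (if s = 0 then {antidiag2 1 (- 1), antidiag2 (- 1) 1} else {})"
    using t s by auto
  finally show ?thesis .
qed

lemma diag2_neq_antidiag2: "p \<noteq> 0 \<Longrightarrow> diag2 p q \<noteq> antidiag2 p' q'"
  by (simp add: diag2_def antidiag2_def vec_eq_iff forall_2)

lemma card_Aut_code:
  assumes "t\<^sup>2 = - 1"
  shows "card (Aut (code t s)) = (if s = 0 then 4 else 2)"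
proof -
  have "diag2 1 1 \<noteq> diag2 (- 1) (- 1)" "antidiag2 1 (- 1) \<noteq> antidiag2 (- 1) 1"
    using f5_one_neq by (simp_all add: diag2_def antidiag2_def vec_eq_iff forall_2)
  then show ?thesis
    using diag2_neq_antidiag2 by (simp add: Aut_code[OF assms] card_insert_if)
qed


section \<open>Weights\<close>

text \<open>Since \<open>t\<close> is invertible, each coordinate of a word vanishes only together
  with the other.\<close>

lemma weight_code:
  assumes "t \<noteq> 0" "c \<in> code t s" "c \<noteq> 0"
  shows "weight c = 2"
proof -
  have "c $ 1 \<noteq> 0"
    using assms(2,3) by (auto simp: code_def zero_i5_def vec_eq_iff forall_2)
  then have "c $ 2 \<noteq> 0"
    using assms(1,2) by (auto simp: code_def zero_i5_def i5.expand)
  with \<open>c $ 1 \<noteq> 0\<close> have "{i. c $ i \<noteq> 0} = UNIV"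
    by (auto simp: forall_2 set_eq_iff)
  then show ?thesis
    by (simp add: weight_def)
qed

lemma card_weight_2_code:
  assumes "t \<noteq> 0"
  shows "card {c \<in> code t s. weight c = 2} = 24"
proof -
  have "weight (0 :: i5 ^ 2) = 0"
    by (simp add: weight_def)
  then have "{c \<in> code t s. weight c = 2} = code t s - {0}"
    using weight_code[OF assms] by auto
  moreover have "0 \<in> code t s"
    using linear_code_code by (auto simp: linear_code_def)
  ultimately show ?thesis
    by (simp add: card_code)
qed

lemma min_distance_code:
  assumes "t \<noteq> 0"
  shows "min_distance (code t s) = 2"
proof -
  have "card (code t s) \<noteq> card {0 :: i5 ^ 2}"
    by (simp add: card_code)
  then have "code t s \<noteq> {0}"
    by metis
  moreover have "0 \<in> code t s"
    using linear_code_code by (auto simp: linear_code_def)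
  ultimately obtain c where "c \<in> code t s" "c \<noteq> 0"
    by blast
  then show ?thesis
    unfolding min_distance_def using weight_code[OF assms] by (intro Least_equality) auto
qed


theorem mainTheorem6:
  fixes C1 C2 C3 :: "(i5 ^ 2) set" and Q :: "(i5 ^ 2) set set"
  defines "C1 \<equiv> generated_code
      (vector [vector [ring_a, 2 \<cdot>\<^sub>5 ring_a]] :: i5 ^ 2 ^ 1)"
    and "C2 \<equiv> generated_code
      (vector [vector [ring_a, 2 \<cdot>\<^sub>5 ring_a + ring_b]] :: i5 ^ 2 ^ 1)"
    and "C3 \<equiv> generated_code
      (vector [vector [ring_a, 2 \<cdot>\<^sub>5 ring_a + 2 \<cdot>\<^sub>5 ring_b]] :: i5 ^ 2 ^ 1)"
    and "Q \<equiv> {C. quasi_self_dual C \<and> has_type C 1 0}"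
  shows "equiv Q {(C, C'). C \<in> Q \<and> C' \<in> Q \<and> monomially_equivalent C C'}
    \<and> card (Q // {(C, C'). C \<in> Q \<and> C' \<in> Q \<and> monomially_equivalent C C'}) = 3
    \<and> {C1, C2, C3} \<subseteq> Q
    \<and> (\<forall>C\<in>Q. monomially_equivalent C1 C \<or> monomially_equivalent C2 C \<or> monomially_equivalent C3 C)
    \<and> \<not> monomially_equivalent C1 C2
    \<and> \<not> monomially_equivalent C1 C3
    \<and> \<not> monomially_equivalent C2 C3
    \<and> card (Aut C1) = 4 \<and> card (Aut C2) = 2 \<and> card (Aut C3) = 2
    \<and> (\<forall>C\<in>{C1, C2, C3}. min_distance C = 2 \<and> card {c \<in> C. weight c = 2} = 24)"
proof -
  define Equiv where "Equiv = {(C, C'). C \<in> Q \<and> C' \<in> Q \<and> monomially_equivalent C C'}"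
  have "C1 = code 2 0" "C2 = code 2 1" "C3 = code 2 2"
    unfolding C1_def C2_def C3_def generated_code_eq_code[symmetric]
    by (simp_all add: f5_scale_def ring_a_def ring_b_def plus_i5_def)
  note C = this
  have Q: "Q = {code t s | t s. t\<^sup>2 = - 1}"
    unfolding Q_def using code_quasi_self_dual quasi_self_dual_type_1_0_imp_code by blast
  have reps: "{C1, C2, C3} \<subseteq> Q"
    using C Q f5_two_squared by auto
  \<comment> \<open>On \<open>Q\<close> equivalence means equal values of \<open>s^2\<close>, so the
    three laws reduce to those of equality.\<close>
  have equiv: "equiv Q Equiv"
    by (rule equivI)
      (auto simp: Equiv_def Q refl_on_def sym_def trans_def monomially_equivalent_code_iff)
  have all: "\<forall>C\<in>Q. monomially_equivalent C1 C \<or> monomially_equivalent C2 C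
      \<or> monomially_equivalent C3 C"
  proof
    fix D assume "D \<in> Q"
    then obtain t s where D: "D = code t s" "t\<^sup>2 = - 1"
      by (auto simp: Q)
    show "monomially_equivalent C1 D \<or> monomially_equivalent C2 D \<or> monomially_equivalent C3 D"
      unfolding C D(1) monomially_equivalent_code_iff[OF f5_two_squared D(2)]
      using f5_square_cases[of s] by auto
  qed
  have ineq: "\<not> monomially_equivalent C1 C2" "\<not> monomially_equivalent C1 C3"
      "\<not> monomially_equivalent C2 C3"
    \<comment> \<open>The invariants of the representatives are 0, 1 and \<open>- 1\<close>, which
      are distinct.\<close>
    unfolding C monomially_equivalent_code_iff[OF f5_two_squared f5_two_squared] f5_two_squared
    using f5_one_neq by simp_all
  have "Q // Equiv = {Equiv `` {C1}, Equiv `` {C2}, Equiv `` {C3}}"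
  proof (intro equalityI subsetI)
    fix X assume "X \<in> Q // Equiv"
    then obtain C where "C \<in> Q" and X: "X = Equiv `` {C}"
      by (rule quotientE)
    then have "(C1, C) \<in> Equiv \<or> (C2, C) \<in> Equiv \<or> (C3, C) \<in> Equiv"
      using all reps by (auto simp: Equiv_def)
    then show "X \<in> {Equiv `` {C1}, Equiv `` {C2}, Equiv `` {C3}}"
      unfolding X using equiv_class_eq[OF equiv] by blast
  qed (use reps in \<open>auto intro: quotientI\<close>)
  moreover have "(C1, C2) \<notin> Equiv" "(C1, C3) \<notin> Equiv" "(C2, C3) \<notin> Equiv"
    using ineq by (simp_all add: Equiv_def)
  then have "Equiv `` {C1} \<noteq> Equiv `` {C2}" "Equiv `` {C1} \<noteq> Equiv `` {C3}"
      "Equiv `` {C2} \<noteq> Equiv `` {C3}"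
    using reps by (simp_all add: eq_equiv_class_iff[OF equiv])
  ultimately have card_quotient: "card (Q // Equiv) = 3"
    by simp
  have Aut: "card (Aut C1) = 4" "card (Aut C2) = 2" "card (Aut C3) = 2"
    using f5_two_neq_0 by (simp_all add: C card_Aut_code[OF f5_two_squared])
  have weights:
      "\<forall>C\<in>{C1, C2, C3}. min_distance C = 2 \<and> card {c \<in> C. weight c = 2} = 24"
    using f5_two_neq_0 by (simp add: C min_distance_code card_weight_2_code)
  show ?thesis
    using equiv card_quotient reps all ineq Aut weights unfolding Equiv_def by (intro conjI)
qed

end
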